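(* For all $k,n\ge0$, the $k$-hypertwist congruence $\equiv^k$ is a lattice congruence of the weak order on the set $\mathfrak P_n$ of ordered partitions of $[n]$.
   Context: An ordered partition $\lambda=\lambda_1|\cdots|\lambda_p$ of $[n]$ is a sequence of non-empty disjoint subsets (parts) with union $[n]$; write $\lambda^{-1}(i)$ for the index of the part containing $i$. Its coinversion map $\mathrm{coinv}(\lambda)$ sends $i<j$ to $-1$ if $\lambda^{-1}(i)<\lambda^{-1}(j)$, $0$ if $\lambda^{-1}(i)=\lambda^{-1}(j)$, $1$ if $\lambda^{-1}(i)>\lambda^{-1}(j)$. The weak order on $\mathfrak P_n$ is $\lambda\le\lambda'$ iff $\mathrm{coinv}(\lambda)(i,j)\le\mathrm{coinv}(\lambda')(i,j)$ for all $i<j$; it is a lattice. The $k$-hypertwist congruence $\equiv^k$ on $\mathfrak P_n$ is the transitive closure of the rewriting rules $U|\mathbf a|\mathbf c|V\equiv^k U|\mathbf a\mathbf c|V\equiv^k U|\mathbf c|\mathbf a|V$, where $\mathbf a,\mathbf c$ are parts, $\mathbf a\mathbf c$ denotes the merged part $\mathbf a\cup\mathbf c$, $U,V$ are sequences of parts, and there exist $k$ distinct elements $b_1,\dots,b_k$ in the union of the parts of $V$ with $\max(\mathbf a)<b_i<\min(\mathbf c)$ for all $i\in[k]$. An equivalence relation on a lattice is a lattice congruence if its classes are intervals and the maps sending each element to the minimum (resp. maximum) of its class are order preserving. *)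

theory Defs
  imports "HOL-Library.Disjoint_Sets" "HOL-Algebra.Lattice"
begin

definition ordered_partitions :: "nat \<Rightarrow> nat set list set" where
  "ordered_partitions n = {ps. distinct ps \<and> partition_on {1..n} (set ps)}"

definition part_index :: "nat set list \<Rightarrow> nat \<Rightarrow> nat" where
  "part_index ps i = (THE p. p < length ps \<and> i \<in> ps ! p)"

definition coinv :: "nat set list \<Rightarrow> nat \<Rightarrow> nat \<Rightarrow> int" where
  "coinv ps i j =
     (if part_index ps i < part_index ps j then -1
      else if part_index ps i = part_index ps j then 0
      else 1)"

definition weak_order :: "nat \<Rightarrow> nat set list gorder" where
  "weak_order n =
     \<lparr>carrier = ordered_partitions n,
      eq = (=),
      le = (\<lambda>ps qs. \<forall>i\<in>{1..n}. \<forall>j\<in>{1..n}. i < j \<longrightarrow> coinv ps i j \<le> coinv qs i j)\<rparr>"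

definition hypertwist_cond :: "nat \<Rightarrow> nat set \<Rightarrow> nat set \<Rightarrow> nat set list \<Rightarrow> bool" where
  "hypertwist_cond k a c V \<longleftrightarrow>
     (\<exists>B. B \<subseteq> \<Union>(set V) \<and> finite B \<and> card B = k \<and> (\<forall>b\<in>B. Max a < b \<and> b < Min c))"

inductive hypertwist_rule :: "nat \<Rightarrow> nat \<Rightarrow> nat set list \<Rightarrow> nat set list \<Rightarrow> bool"
  for k n :: nat where
  merge: "\<lbrakk>U @ [a, c] @ V \<in> ordered_partitions n; hypertwist_cond k a c V\<rbrakk>
            \<Longrightarrow> hypertwist_rule k n (U @ [a, c] @ V) (U @ [a \<union> c] @ V)"
| split: "\<lbrakk>U @ [a, c] @ V \<in> ordered_partitions n; hypertwist_cond k a c V\<rbrakk>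
            \<Longrightarrow> hypertwist_rule k n (U @ [a \<union> c] @ V) (U @ [c, a] @ V)"

definition hypertwist_congruence :: "nat \<Rightarrow> nat \<Rightarrow> nat set list rel" where
  "hypertwist_congruence k n =
     {(ps, qs). ps \<in> ordered_partitions n \<and> qs \<in> ordered_partitions n \<and>
                equivclp (hypertwist_rule k n) ps qs}"

definition class_min :: "'a gorder \<Rightarrow> 'a rel \<Rightarrow> 'a \<Rightarrow> 'a" where
  "class_min L R x = (THE m. least L m (R `` {x}))"

definition class_max :: "'a gorder \<Rightarrow> 'a rel \<Rightarrow> 'a \<Rightarrow> 'a" where
  "class_max L R x = (THE m. greatest L m (R `` {x}))"

definition lattice_congruence :: "'a gorder \<Rightarrow> 'a rel \<Rightarrow> bool" where
  "lattice_congruence L R \<longleftrightarrow>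
     lattice L \<and>
     equiv (carrier L) R \<and>
     (\<forall>C\<in>carrier L // R. \<exists>l\<in>carrier L. \<exists>u\<in>carrier L. C = \<lbrace>l..u\<rbrace>\<^bsub>L\<^esub>) \<and>
     isotone L L (class_min L R) \<and>
     isotone L L (class_max L R)"

end

theory Submission
  imports Defs
begin

text \<open>
  For \<open>k > 0\<close> the rules \<open>U|a|c|V \<rightarrow> U|ac|V \<rightarrow> U|c|a|V\<close> increase the weak order. The key point is
  that if \<open>x \<rightarrow> y\<close>, and \<open>m \<le> y\<close> admits no backward move, then already \<open>m \<le> x\<close>. Otherwise \<open>m\<close> puts
  some \<open>j \<in> c\<close> weakly before some \<open>i \<in> a\<close>; comparison with \<open>y\<close> shows that the \<open>k\<close> witnesses come after
  \<open>i\<close> in \<open>m\<close> and that no value between \<open>max a\<close> and \<open>min c\<close> occurs in \<open>m\<close> from the part of \<open>j\<close> to the part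
  of \<open>i\<close>, so that \<open>m\<close> has a backward move there. Hence going backwards from \<open>x\<close> ends in the greatest
  irreducible element below \<open>x\<close>. It depends monotonically on \<open>x\<close>, is constant on congruence classes,
  and is therefore the minimum of the class of \<open>x\<close>. The complement \<open>i \<mapsto> n + 1 - i\<close> reverses the weak
  order and exchanges the two rules, which gives the maxima, and also reduces meets to joins.
\<close>

subsection \<open>Congruences generated by increasing moves\<close>

text \<open>Stated for a partial order alone, so that the dual order with reversed moves is covered
  too. \<open>d x\<close> is the greatest element below \<open>x\<close> that admits no backward
  move.\<close>

lemma (in partial_order) least_of_moves:
  fixes r :: "'a \<Rightarrow> 'a \<Rightarrow> bool"
  defines "R \<equiv> {(x, y). x \<in> carrier L \<and> y \<in> carrier L \<and> equivclp r x y}"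
  assumes fin: "finite (carrier L)"
    and move: "\<And>x y. r x y \<Longrightarrow> x \<in> carrier L \<and> y \<in> carrier L \<and> x \<sqsubseteq> y \<and> x \<noteq> y"
    and pass: "\<And>x y m. \<lbrakk>r x y; m \<in> carrier L; \<nexists>z. r z m; m \<sqsubseteq> y\<rbrakk> \<Longrightarrow> m \<sqsubseteq> x"
  obtains d where "\<And>x. x \<in> carrier L \<Longrightarrow> least L (d x) (R `` {x})"
    and "\<And>x y. \<lbrakk>x \<in> carrier L; y \<in> carrier L; x \<sqsubseteq> y\<rbrakk> \<Longrightarrow> d x \<sqsubseteq> d y"
proof -
  define N where "N = {m \<in> carrier L. \<nexists>z. r z m}"
  \<comment> \<open>Induction on the size of the down-set of \<open>x\<close>, which shrinks
    strictly along a backward move \<open>r y x\<close>. By \<open>pass\<close>, irreducible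
    elements below \<open>x\<close> are below \<open>y\<close>, so the normal form of
    \<open>y\<close> serves for \<open>x\<close>.\<close>
  have nf: "\<exists>m\<in>N. m \<sqsubseteq> x \<and> equivclp r x m \<and> (\<forall>m'\<in>N. m' \<sqsubseteq> x \<longrightarrow> m' \<sqsubseteq> m)"
    if "x \<in> carrier L" for x
    using that
  proof (induction "card {y \<in> carrier L. y \<sqsubseteq> x}" arbitrary: x rule: less_induct)
    case less
    show ?case
    proof (cases "\<exists>y. r y x")
      case False
      then show ?thesis using less.prems by (intro bexI[of _ x]) (auto simp: N_def)
    next
      case True
      then obtain y where y: "r y x" by blast
      note yx = move[OF y]
      have "{z \<in> carrier L. z \<sqsubseteq> y} \<subset> {z \<in> carrier L. z \<sqsubseteq> x}"
        using yx le_trans le_antisym le_refl by blast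
      then have "card {z \<in> carrier L. z \<sqsubseteq> y} < card {z \<in> carrier L. z \<sqsubseteq> x}"
        using fin by (intro psubset_card_mono) auto
      from less.hyps[OF this] yx obtain m where m: "m \<in> N" "m \<sqsubseteq> y" "equivclp r y m"
        "\<And>m'. m' \<in> N \<Longrightarrow> m' \<sqsubseteq> y \<Longrightarrow> m' \<sqsubseteq> m" by blast
      have "m \<sqsubseteq> x" using m yx le_trans N_def by blast
      moreover have "equivclp r x m"
        using y m(3) by (meson r_into_equivclp equivclp_sym equivclp_trans)
      moreover have "m' \<sqsubseteq> m" if "m' \<in> N" "m' \<sqsubseteq> x" for m'
        using that m(4) pass[OF y] by (auto simp: N_def)
      ultimately show ?thesis using m(1) by blast
    qed
  qed
  then obtain d where d: "\<And>x. x \<in> carrier L \<Longrightarrow> d x \<in> N \<and> d x \<sqsubseteq> x \<and> equivclp r x (d x)"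
    and d_max: "\<And>x m. \<lbrakk>x \<in> carrier L; m \<in> N; m \<sqsubseteq> x\<rbrakk> \<Longrightarrow> m \<sqsubseteq> d x"
    by metis
  have NC: "N \<subseteq> carrier L" by (auto simp: N_def)
  have mono: "d x \<sqsubseteq> d y" if "x \<in> carrier L" "y \<in> carrier L" "x \<sqsubseteq> y" for x y
    using that d d_max le_trans NC by (meson subsetD)
  have d_move: "d x = d y" if "r x y" for x y
  proof (rule le_antisym)
    note xy = move[OF that]
    show "d x \<sqsubseteq> d y" using xy mono by blast
    \<comment> \<open>\<open>d y\<close> is irreducible and below \<open>y\<close>, so
      \<open>pass\<close> puts it below \<open>x\<close>, where \<open>d x\<close> is the greatest
      irreducible element.\<close>
    show "d y \<sqsubseteq> d x" using xy d d_max pass[OF that, of "d y"] NC by (auto simp: N_def)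
  qed (use move[OF that] d NC in blast)+
  have d_eq: "d x = d y" if "equivclp r x y" for x y
    using that by (induction rule: equivclp_induct) (auto dest: d_move)
  have "least L (d x) (R `` {x})" if "x \<in> carrier L" for x
  proof -
    have "d x \<sqsubseteq> y" if "y \<in> carrier L" "equivclp r x y" for y
      using d[OF that(1)] d_eq[OF that(2)] by simp
    then show ?thesis using that d[OF that] NC by (auto simp: least_def R_def)
  qed
  then show thesis using mono that by blast
qed

text \<open>Minima come from \<open>least_of_moves\<close> in \<open>L\<close>, maxima from the same
  lemma in the dual order. An element squeezed between the two ends of a class has the same minimum
  by monotonicity, so classes are intervals.\<close>

lemma lattice_congruence_of_moves:
  fixes L :: "'a gorder" (structure) and r :: "'a \<Rightarrow> 'a \<Rightarrow> bool"
  assumes "lattice L" and fin: "finite (carrier L)"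
    and move: "\<And>x y. r x y \<Longrightarrow> x \<in> carrier L \<and> y \<in> carrier L \<and> x \<sqsubseteq> y \<and> x \<noteq> y"
    and down: "\<And>x y m. \<lbrakk>r x y; m \<in> carrier L; \<nexists>z. r z m; m \<sqsubseteq> y\<rbrakk> \<Longrightarrow> m \<sqsubseteq> x"
    and up: "\<And>x y m. \<lbrakk>r x y; m \<in> carrier L; \<nexists>z. r m z; x \<sqsubseteq> m\<rbrakk> \<Longrightarrow> y \<sqsubseteq> m"
  shows "lattice_congruence L {(x, y). x \<in> carrier L \<and> y \<in> carrier L \<and> equivclp r x y}"
    (is "lattice_congruence L ?R")
proof -
  interpret lattice L by fact
  interpret dual: lattice "inv_gorder L" by (rule dual_lattice)
  obtain d where d: "\<And>x. x \<in> carrier L \<Longrightarrow> least L (d x) (?R `` {x})"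
    and d_mono: "\<And>x y. \<lbrakk>x \<in> carrier L; y \<in> carrier L; x \<sqsubseteq> y\<rbrakk> \<Longrightarrow> d x \<sqsubseteq> d y"
    using least_of_moves[OF fin, of r] move down by blast
  obtain u where u: "\<And>x. x \<in> carrier L \<Longrightarrow> greatest L (u x) (?R `` {x})"
    and u_mono: "\<And>x y. \<lbrakk>x \<in> carrier L; y \<in> carrier L; x \<sqsubseteq> y\<rbrakk> \<Longrightarrow> u x \<sqsubseteq> u y"
  \<comment> \<open>The reversed moves generate the same equivalence, \<open>least\<close> turns
    into \<open>greatest\<close>, and \<open>up\<close> takes the place of
    \<open>pass\<close>.\<close>
  proof (rule dual.least_of_moves[of "r\<inverse>\<inverse>"])
    show "finite (carrier (inv_gorder L))" using fin by simp
    fix u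
    assume "\<And>x. x \<in> carrier (inv_gorder L) \<Longrightarrow>
        least (inv_gorder L) (u x)
          ({(x, y). x \<in> carrier (inv_gorder L) \<and> y \<in> carrier (inv_gorder L) \<and>
             equivclp (r\<inverse>\<inverse>) x y} `` {x})"
      and "\<And>x y. \<lbrakk>x \<in> carrier (inv_gorder L); y \<in> carrier (inv_gorder L); x \<sqsubseteq>\<^bsub>inv_gorder L\<^esub> y\<rbrakk>
        \<Longrightarrow> u x \<sqsubseteq>\<^bsub>inv_gorder L\<^esub> u y"
    then show thesis using that[of u] by simp
  next
    fix x y assume "r\<inverse>\<inverse> x y"
    then have "r y x" by simp
    from move[OF this] show "x \<in> carrier (inv_gorder L) \<and> y \<in> carrier (inv_gorder L) \<and>
        x \<sqsubseteq>\<^bsub>inv_gorder L\<^esub> y \<and> x \<noteq> y"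
      by auto
  qed (use up in auto)
  have equiv: "equiv (carrier L) ?R"
    by (rule equivI) (auto simp: refl_on_def sym_def trans_def
        intro: equivclp_sym equivclp_trans)
  have class_eq: "?R `` {x} = ?R `` {y}" if "(x, y) \<in> ?R" for x y
    using equiv that by (rule equiv_class_eq)
  have min: "class_min L ?R x = d x" if "x \<in> carrier L" for x
    unfolding class_min_def by (rule the_equality) (use d[OF that] least_unique in blast)+
  have max: "class_max L ?R x = u x" if "x \<in> carrier L" for x
    unfolding class_max_def by (rule the_equality) (use u[OF that] greatest_unique in blast)+
  have d_rel: "(x, d x) \<in> ?R" if "x \<in> carrier L" for x
    using least_mem[OF d[OF that]] by simp
  have u_rel: "(x, u x) \<in> ?R" if "x \<in> carrier L" for x
    using u[OF that] by (simp add: greatest_def)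
  have d_eq: "d x = d y" if "(x, y) \<in> ?R" for x y
    using d[of x] d[of y] that class_eq[OF that] least_unique by auto
  have "?R `` {x} = \<lbrace>d x..u x\<rbrace>" if x: "x \<in> carrier L" for x
  proof
    show "?R `` {x} \<subseteq> \<lbrace>d x..u x\<rbrace>"
      using d[OF x] u[OF x] by (auto simp: at_least_at_most_def least_def greatest_def)
    show "\<lbrace>d x..u x\<rbrace> \<subseteq> ?R `` {x}"
    proof
      fix y assume "y \<in> \<lbrace>d x..u x\<rbrace>"
      then have y: "y \<in> carrier L" "d x \<sqsubseteq> y" "y \<sqsubseteq> u x" by (auto simp: at_least_at_most_def)
      \<comment> \<open>\<open>d (d x)\<close> and \<open>d (u x)\<close> both equal
        \<open>d x\<close>, as the arguments lie in the class of \<open>x\<close>; monotonicity then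
        traps \<open>d y\<close>.\<close>
      have "d x \<sqsubseteq> d y" using d_mono[OF _ y(1,2)] d_eq[OF d_rel[OF x]] d_rel[OF x] by simp
      moreover have "d y \<sqsubseteq> d x" using d_mono[OF y(1) _ y(3)] d_eq[OF u_rel[OF x]] u_rel[OF x] by simp
      ultimately have "d x = d y" using d_rel x y by (intro le_antisym) auto
      then show "y \<in> ?R `` {x}"
        using d_rel[OF x] d_rel[OF y(1)] by (auto intro: equivclp_sym equivclp_trans)
    qed
  qed
  moreover have "d x \<in> carrier L" "u x \<in> carrier L" if "x \<in> carrier L" for x
    using d_rel[OF that] u_rel[OF that] by auto
  ultimately have "\<forall>C\<in>carrier L // ?R. \<exists>l\<in>carrier L. \<exists>u\<in>carrier L. C = \<lbrace>l..u\<rbrace>"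
    by (metis (no_types, lifting) quotientE)
  moreover have "isotone L L (class_min L ?R)" "isotone L L (class_max L ?R)"
    by (rule isotoneI; use weak_partial_order_axioms min max d_mono u_mono in auto)+
  ultimately show ?thesis
    using equiv \<open>lattice L\<close> by (simp add: lattice_congruence_def)
qed

text \<open>Serves the case \<open>k = 0\<close>. With all strict comparisons as moves, any two
  elements are linked through their join, and an element without a backward move is minimal, hence
  the bottom of the lattice; dually for the top.\<close>

lemma lattice_congruence_total:
  fixes L :: "'a gorder" (structure)
  assumes "lattice L" and "finite (carrier L)"
  shows "lattice_congruence L (carrier L \<times> carrier L)"
proof -
  interpret lattice L by fact
  define r where "r x y \<longleftrightarrow> x \<in> carrier L \<and> y \<in> carrier L \<and> x \<sqsubseteq> y \<and> x \<noteq> y" for x y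
  have le: "equivclp r x y" if "x \<in> carrier L" "y \<in> carrier L" "x \<sqsubseteq> y" for x y
    using that by (cases "x = y") (auto simp: r_def)
  have "equivclp r x y" if "x \<in> carrier L" "y \<in> carrier L" for x y
    using that le[of x "x \<squnion> y"] le[of y "x \<squnion> y"] join_left join_right join_closed
    by (meson equivclp_sym equivclp_trans)
  then have "{(x, y). x \<in> carrier L \<and> y \<in> carrier L \<and> equivclp r x y} = carrier L \<times> carrier L"
    by auto
  moreover have "lattice_congruence L {(x, y). x \<in> carrier L \<and> y \<in> carrier L \<and> equivclp r x y}"
  proof (rule lattice_congruence_of_moves[OF assms])
    fix x y m assume "r x y" and m: "m \<in> carrier L"
    then have xy: "x \<in> carrier L" "y \<in> carrier L" by (auto simp: r_def)
    show "m \<sqsubseteq> x" if "\<nexists>z. r z m"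
    proof -
      have "m \<sqinter> x = m" using that m xy meet_left meet_closed unfolding r_def by blast
      then show ?thesis using meet_right[OF m xy(1)] by simp
    qed
    show "y \<sqsubseteq> m" if "\<nexists>z. r m z"
    proof -
      have "m \<squnion> y = m" using that m xy join_left join_closed unfolding r_def by metis
      then show ?thesis using join_right[OF m xy(2)] by simp
    qed
  qed (auto simp: r_def)
  ultimately show ?thesis by simp
qed

subsection \<open>Ordered partitions\<close>

text \<open>A non-empty part is not disjoint from itself, so disjointness along the list already
  yields \<open>distinct\<close>. This form decomposes well over \<open>@\<close>.\<close>

lemma ordered_partitions_iff:
  "ps \<in> ordered_partitions n \<longleftrightarrow>
     \<Union>(set ps) = {1..n} \<and> {} \<notin> set ps \<and> sorted_wrt disjnt ps"
proof -
  have "distinct ps \<and> pairwise disjnt (set ps) \<longleftrightarrow> sorted_wrt disjnt ps" if "{} \<notin> set ps"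
    using that
  proof (induction ps)
    case (Cons a ps)
    then show ?case by (auto simp: pairwise_insert disjnt_sym)
  qed simp
  then show ?thesis
    by (auto simp: ordered_partitions_def partition_on_def)
qed

lemma finite_ordered_partitions: "finite (ordered_partitions n)"
proof (rule finite_subset)
  show "ordered_partitions n \<subseteq> {ps. set ps \<subseteq> Pow {1..n} \<and> distinct ps}"
    by (auto simp: ordered_partitions_def partition_on_def)
qed (rule finite_subset_distinct, simp)

lemma part_index_eqI:
  assumes "ps \<in> ordered_partitions n" "p < length ps" "i \<in> ps ! p"
  shows "part_index ps i = p"
  unfolding part_index_def
proof (rule the_equality)
  fix q assume q: "q < length ps \<and> i \<in> ps ! q"
  have "sorted_wrt disjnt ps" using assms(1) by (simp add: ordered_partitions_iff)
  then show "q = p"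
    using sorted_wrt_nth_less[of disjnt ps p q] sorted_wrt_nth_less[of disjnt ps q p] q assms(2,3)
    by (cases p q rule: linorder_cases) (auto simp: disjnt_iff)
qed (use assms in auto)

lemma part_index_mem:
  assumes "ps \<in> ordered_partitions n" "i \<in> {1..n}"
  shows "part_index ps i < length ps" "i \<in> ps ! part_index ps i"
proof -
  obtain p where "p < length ps" "i \<in> ps ! p"
    using assms by (metis UnionE in_set_conv_nth ordered_partitions_iff)
  then show "part_index ps i < length ps" "i \<in> ps ! part_index ps i"
    using part_index_eqI[OF assms(1)] by auto
qed

lemma nth_ordered_partition:
  assumes "ps \<in> ordered_partitions n" "p < length ps"
  shows "ps ! p = {i \<in> {1..n}. part_index ps i = p}"
proof -
  have "ps ! p \<subseteq> {1..n}" using assms by (auto simp: ordered_partitions_iff)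
  then show ?thesis using assms part_index_eqI part_index_mem by blast
qed

lemma ordered_partition_nth_nonempty:
  "\<lbrakk>ps \<in> ordered_partitions n; p < length ps\<rbrakk> \<Longrightarrow> ps ! p \<noteq> {}"
  by (auto simp: ordered_partitions_iff dest: nth_mem)

lemma part_index_image:
  assumes "ps \<in> ordered_partitions n"
  shows "part_index ps ` {1..n} = {..<length ps}"
proof -
  have "\<exists>i\<in>{1..n}. part_index ps i = p" if "p < length ps" for p
    using ordered_partition_nth_nonempty[OF assms that] nth_ordered_partition[OF assms that] by auto
  then show ?thesis using part_index_mem(1)[OF assms] by force
qed

text \<open>An ordered partition is a total preorder on [n]. Its indices have no gaps, so they can
  be recovered from the preorder by counting steps of strict chains.\<close>

lemma ordered_partition_eqI:
  assumes ps: "ps \<in> ordered_partitions n" and qs: "qs \<in> ordered_partitions n"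
    and iff: "\<And>i j. \<lbrakk>i \<in> {1..n}; j \<in> {1..n}\<rbrakk> \<Longrightarrow>
      part_index ps i \<le> part_index ps j \<longleftrightarrow> part_index qs i \<le> part_index qs j"
  shows "ps = qs"
proof -
  \<comment> \<open>Induction on the index: some value sits at the preceding index, and its strict
    step to \<open>i\<close> survives in \<open>rs'\<close>.\<close>
  have le: "part_index rs i \<le> part_index rs' i"
    if rs: "rs \<in> ordered_partitions n" and i: "i \<in> {1..n}"
      and mono: "\<And>i j. \<lbrakk>i \<in> {1..n}; j \<in> {1..n}; part_index rs i < part_index rs j\<rbrakk> \<Longrightarrow>
        part_index rs' i < part_index rs' j"
    for rs rs' i
    using i
  proof (induction "part_index rs i" arbitrary: i)
    case (Suc p)
    then have "p \<in> part_index rs ` {1..n}"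
      using part_index_image[OF rs] part_index_mem(1)[OF rs, of i] by simp
    then obtain j where j: "j \<in> {1..n}" "p = part_index rs j" by blast
    then have "part_index rs' j < part_index rs' i" using Suc mono[of j i] by simp
    with Suc(1)[OF j(2,1)] Suc(2) j(2) show ?case by simp
  qed simp
  have "part_index ps i = part_index qs i" if "i \<in> {1..n}" for i
    using le[OF ps that, of qs] le[OF qs that, of ps] iff by (meson le_antisym not_less)
  then have fg: "\<forall>i\<in>{1..n}. part_index ps i = part_index qs i" by blast
  then have "{..<length ps} = {..<length qs}"
    using fg part_index_image[OF ps] part_index_image[OF qs] by (metis image_cong)
  then have len: "length ps = length qs" by simp
  then show ?thesis
    using nth_ordered_partition[OF ps] nth_ordered_partition[OF qs] fg
    by (intro nth_equalityI) auto
qed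

text \<open>The parts are the fibres of \<open>h\<close>, listed by increasing value.\<close>

lemma ordered_partition_of_rank:
  fixes h :: "nat \<Rightarrow> nat"
  obtains ps where "ps \<in> ordered_partitions n"
    and "\<And>i j. \<lbrakk>i \<in> {1..n}; j \<in> {1..n}\<rbrakk> \<Longrightarrow> part_index ps i \<le> part_index ps j \<longleftrightarrow> h i \<le> h j"
proof -
  define xs where "xs = sorted_list_of_set (h ` {1..n})"
  define ps where "ps = map (\<lambda>v. {i \<in> {1..n}. h i = v}) xs"
  have xs: "sorted_wrt (<) xs" "set xs = h ` {1..n}"
    by (auto simp: xs_def)
  have "sorted_wrt disjnt ps"
    unfolding ps_def sorted_wrt_map
    by (rule sorted_wrt_mono_rel[OF _ xs(1)]) (auto simp: disjnt_def)
  then have ps: "ps \<in> ordered_partitions n"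
    using xs(2) by (auto simp: ordered_partitions_iff ps_def)
  have idx: "part_index ps i < length xs \<and> xs ! part_index ps i = h i" if "i \<in> {1..n}" for i
    using part_index_mem[OF ps that] by (auto simp: ps_def)
  have mono: "part_index ps i < part_index ps j \<Longrightarrow> h i < h j" if "i \<in> {1..n}" "j \<in> {1..n}" for i j
    using idx that sorted_wrt_nth_less[OF xs(1)] by metis
  have "part_index ps i \<le> part_index ps j \<longleftrightarrow> h i \<le> h j" if "i \<in> {1..n}" "j \<in> {1..n}" for i j
    using mono[OF that] mono[OF that(2,1)] idx[OF that(1)] idx[OF that(2)]
    by (metis le_less_linear less_le_not_le nat_less_le)
  then show thesis using that ps by blast
qed

text \<open>Counting weak predecessors turns a total preorder into a rank function. If
  \<open>R i j\<close> fails, \<open>i\<close> is counted for itself but not for \<open>j\<close>,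
  so the ranks differ.\<close>

lemma ordered_partition_of_preorder:
  assumes total: "\<And>i j. \<lbrakk>i \<in> {1..n}; j \<in> {1..n}\<rbrakk> \<Longrightarrow> R i j \<or> R j i"
    and trans: "\<And>i j l. \<lbrakk>i \<in> {1..n}; j \<in> {1..n}; l \<in> {1..n}; R i j; R j l\<rbrakk> \<Longrightarrow> R i l"
  obtains ps where "ps \<in> ordered_partitions n"
    and "\<And>i j. \<lbrakk>i \<in> {1..n}; j \<in> {1..n}\<rbrakk> \<Longrightarrow> part_index ps i \<le> part_index ps j \<longleftrightarrow> R i j"
proof -
  define h where "h i = card {l \<in> {1..n}. R l i}" for i
  have "h i \<le> h j \<longleftrightarrow> R i j" if ij: "i \<in> {1..n}" "j \<in> {1..n}" for i j
  proof
    assume "R i j"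
    then have "{l \<in> {1..n}. R l i} \<subseteq> {l \<in> {1..n}. R l j}" using ij trans by blast
    then show "h i \<le> h j" unfolding h_def by (intro card_mono) auto
  next
    assume le: "h i \<le> h j"
    show "R i j"
    proof (rule ccontr)
      assume neg: "\<not> R i j"
      then have "R j i" using total ij by blast
      then have "{l \<in> {1..n}. R l j} \<subseteq> {l \<in> {1..n}. R l i}" using ij trans by blast
      moreover have "i \<in> {l \<in> {1..n}. R l i} - {l \<in> {1..n}. R l j}"
        using ij total[of i i] neg by auto
      ultimately have "h j < h i" unfolding h_def by (intro psubset_card_mono) auto
      with le show False by simp
    qed
  qed
  then show thesis using ordered_partition_of_rank[of n h] that by (metis (no_types))
qed

subsection \<open>The weak order\<close>

lemma carrier_weak_order [simp]: "carrier (weak_order n) = ordered_partitions n"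
  by (simp add: weak_order_def)

text \<open>\<open>coinv\<close> takes only the values -1, 0, 1, so comparing it means preserving
  the thresholds 0 and 1, that is, weak and strict inversions.\<close>

lemma le_weak_order_iff:
  "ps \<sqsubseteq>\<^bsub>weak_order n\<^esub> qs \<longleftrightarrow>
     (\<forall>i\<in>{1..n}. \<forall>j\<in>{1..n}. i < j \<longrightarrow>
        (part_index ps j \<le> part_index ps i \<longrightarrow> part_index qs j \<le> part_index qs i) \<and>
        (part_index ps j < part_index ps i \<longrightarrow> part_index qs j < part_index qs i))"
  unfolding weak_order_def coinv_def by (simp, intro ball_cong refl) auto

lemma partial_order_weak_order: "partial_order (weak_order n)"
proof (unfold_locales, goal_cases)
  case (5 x y)
  have "x = y"
  proof (rule ordered_partition_eqI)
    fix i j assume "i \<in> {1..n}" "j \<in> {1..n}"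
    then show "part_index x i \<le> part_index x j \<longleftrightarrow> part_index y i \<le> part_index y j"
      using 5(1,2) unfolding le_weak_order_iff
      by (cases i j rule: linorder_cases) (auto simp flip: not_less simp del: atLeastAtMost_iff)
  qed (use 5 in auto)
  then show ?case by (simp add: weak_order_def)
next
  case (6 x y z)
  then show ?case unfolding le_weak_order_iff by blast
next
  case (7 x y z w)
  then show ?case by (simp add: weak_order_def)
qed (auto simp: weak_order_def)

text \<open>The join: its weak inversions are the transitive closure of the weak inversions of the
  members of the family, and such a chain becomes a strict inversion as soon as one of its
  steps is strict.\<close>

lemma weak_order_sup_exists:
  assumes F: "F \<subseteq> ordered_partitions n"
  shows "\<exists>s. least (weak_order n) s (Upper (weak_order n) F)"
proof -
  \<comment> \<open>Pairs carry the larger value first, so chains in \<open>B\<close> decrease.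
    \<open>A\<close> holds the strict inversions, and \<open>S\<close> the chains with at least one
    strict step.\<close>
  define B where "B = {(j, i). i \<in> {1..n} \<and> j \<in> {1..n} \<and> i < j \<and>
    (\<exists>ps\<in>F. part_index ps j \<le> part_index ps i)}"
  define A where "A = {(j, i). i \<in> {1..n} \<and> j \<in> {1..n} \<and> i < j \<and>
    (\<exists>ps\<in>F. part_index ps j < part_index ps i)}"
  define S where "S = B\<^sup>* O A O B\<^sup>*"
  have AS: "A \<subseteq> S" by (auto simp: S_def)
  have AB: "A \<subseteq> B" by (force simp: A_def B_def)
  have BS: "(x, z) \<in> S" if "(x, y) \<in> B\<^sup>*" "(y, z) \<in> S" for x y z
    using that unfolding S_def by (meson relcomp.simps rtrancl_trans)
  have SB: "(x, z) \<in> S" if "(x, y) \<in> S" "(y, z) \<in> B\<^sup>*" for x y z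
    using that unfolding S_def by (meson relcomp.simps rtrancl_trans)
  have S_sub: "S \<subseteq> B\<^sup>+"
    using AB unfolding S_def by (auto intro: rtrancl_into_trancl1 rtrancl_trancl_trancl
        trancl_rtrancl_trancl)
  have B_gr: "y < x \<and> x \<in> {1..n} \<and> y \<in> {1..n}" if "(x, y) \<in> B\<^sup>+" for x y
    using that by (induction rule: trancl.induct) (auto simp: B_def)
  \<comment> \<open>In a member that puts \<open>x\<close> weakly before \<open>z\<close>, the value
    \<open>y\<close> lies strictly after \<open>x\<close> or weakly before \<open>z\<close>, and
    also weakly after \<open>x\<close> or strictly before \<open>z\<close>.\<close>
  have crossing: "((x, y) \<in> A \<or> (y, z) \<in> B) \<and> ((x, y) \<in> B \<or> (y, z) \<in> A)"
    if xz: "(x, z) \<in> B" and y: "z < y" "y < x" for x y z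
  proof -
    obtain ps where "ps \<in> F" "part_index ps x \<le> part_index ps z" "x \<in> {1..n}" "z \<in> {1..n}"
      using xz by (auto simp: B_def)
    moreover from this y have "y \<in> {1..n}" by auto
    ultimately show ?thesis using y unfolding A_def B_def
      by (simp del: atLeastAtMost_iff) (meson le_less_linear le_less_trans less_le_trans order_trans)
  qed
  \<comment> \<open>Follow the chain from \<open>x\<close> to the first step that reaches or jumps
    over \<open>y\<close>. \<open>crossing\<close> cuts a jump at \<open>y\<close>; its other
    outcome would put \<open>(x, y)\<close> into \<open>S\<close>. \<open>upper\<close> is the
    mirror image.\<close>
  have lower: "(y, z) \<in> B\<^sup>+" if "(x, z) \<in> B\<^sup>+" "z < y" "y < x" "(x, y) \<notin> S" for x y z
    using that
  proof (induction rule: converse_trancl_induct)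
    case (base x)
    then show ?case using crossing AS by blast
  next
    case (step x w)
    show ?case
    proof (cases w y rule: linorder_cases)
      case less
      then have "(y, w) \<in> B" using crossing step.prems step.hyps AS by blast
      then show ?thesis using step by auto
    next
      case equal
      then show ?thesis using step by auto
    next
      case greater
      then have "(w, y) \<notin> S" using step BS by blast
      then show ?thesis using step greater by blast
    qed
  qed
  have upper: "(x, y) \<in> B\<^sup>+" if "(x, z) \<in> B\<^sup>+" "z < y" "y < x" "(y, z) \<notin> S" for x y z
    using that
  proof (induction rule: trancl_induct)
    case (base z)
    then show ?case using crossing AS by blast
  next
    case (step w z)
    show ?case
    proof (cases y w rule: linorder_cases)
      case less
      then have "(w, y) \<in> B" using crossing step.prems step.hyps AS by blast
      then show ?thesis using step by auto
    next
      case equal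
      then show ?thesis using step by auto
    next
      case greater
      then have "(y, w) \<notin> S" using step SB by blast
      then show ?thesis using step greater by blast
    qed
  qed
  \<comment> \<open>Non-inversions must be transitive. The cases place \<open>y\<close> relative to
    one strict step from \<open>u\<close> to \<open>v\<close> of the chain: above it, below it, or
    inside.\<close>
  have coclosed: "(x, y) \<in> S \<or> (y, z) \<in> S" if "(x, z) \<in> S" "z < y" "y < x" for x y z
  proof (rule ccontr)
    assume "\<not> ((x, y) \<in> S \<or> (y, z) \<in> S)"
    then have neg: "(x, y) \<notin> S" "(y, z) \<notin> S" by auto
    obtain u v where uv: "(x, u) \<in> B\<^sup>*" "(u, v) \<in> A" "(v, z) \<in> B\<^sup>*"
      using \<open>(x, z) \<in> S\<close> by (auto simp: S_def)
    have Suz: "(u, z) \<in> S" and Sxv: "(x, v) \<in> S"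
      using uv by (auto simp: S_def)
    consider "u \<le> y" | "y \<le> v" | "v < y" "y < u" by linarith
    then show False
    proof cases
      case 1
      then have "(y, u) \<in> B\<^sup>*"
        using lower[of x u y] uv(1) that neg by (cases "u = y") (auto simp: rtrancl_eq_or_trancl)
      then show False using BS Suz neg by blast
    next
      case 2
      then have "(v, y) \<in> B\<^sup>*"
        using upper[of v z y] uv(3) that neg by (cases "v = y") (auto simp: rtrancl_eq_or_trancl)
      then show False using SB Sxv neg by blast
    next
      case 3
      obtain ps where "ps \<in> F" "part_index ps u < part_index ps v" "u \<in> {1..n}" "v \<in> {1..n}"
        using uv(2) by (auto simp: A_def)
      moreover from this 3 have "y \<in> {1..n}" by auto
      ultimately have "(u, y) \<in> A \<or> (y, v) \<in> A"
        using 3 unfolding A_def by (simp del: atLeastAtMost_iff) (meson le_less_trans not_less)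
      then show False using uv neg by (auto simp: S_def)
    qed
  qed
  \<comment> \<open>The join as a preorder, with \<open>R x y\<close> read as \<open>x\<close>
    weakly before \<open>y\<close>: its strict inversions are the pairs in \<open>S\<close>, its
    weak inversions those in \<open>B\<^sup>+\<close>.\<close>
  define R where "R x y \<longleftrightarrow> (if x < y then (y, x) \<notin> S else x = y \<or> (x, y) \<in> B\<^sup>+)" for x y
  have total: "R x y \<or> R y x" for x y
    using S_sub by (auto simp: R_def)
  have trans: "R x z" if "R x y" "R y z" for x y z
  proof -
    \<comment> \<open>Apart from equalities, these are the six orders of three values. For
      \<open>x < z\<close> the pair \<open>(z, x)\<close> must stay outside \<open>S\<close>; for
      \<open>z < x\<close> a chain from \<open>x\<close> to \<open>z\<close> must be found.\<close>
    consider "x = y \<or> y = z \<or> x = z" | "x < y" "y < z" | "x < z" "z < y" | "y < x" "x < z"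
      | "y < z" "z < x" | "z < x" "x < y" | "z < y" "y < x" by linarith
    then show ?thesis
    proof cases
      case 1 then show ?thesis using that by (auto simp: R_def)
    next
      case 2 then show ?thesis using that coclosed[of z x y] by (auto simp: R_def)
    next
      case 3 then show ?thesis using that BS[of y z x] by (auto simp: R_def dest: trancl_into_rtrancl)
    next
      case 4 then show ?thesis
        using that SB[of z x y] by (auto simp: R_def dest: trancl_into_rtrancl)
    next
      case 5 then show ?thesis using that upper[of x y z] by (auto simp: R_def)
    next
      case 6 then show ?thesis using that lower[of y z x] by (auto simp: R_def)
    next
      case 7 then show ?thesis using that by (auto simp: R_def)
    qed
  qed
  obtain s where s: "s \<in> ordered_partitions n"
    and sR: "\<And>i j. \<lbrakk>i \<in> {1..n}; j \<in> {1..n}\<rbrakk> \<Longrightarrow> part_index s i \<le> part_index s j \<longleftrightarrow> R i j"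
    using ordered_partition_of_preorder[of n R] total trans by blast
  have sR': "part_index s j < part_index s i \<longleftrightarrow> \<not> R i j" if "i \<in> {1..n}" "j \<in> {1..n}" for i j
    using sR[OF that] by linarith
  have "ps \<sqsubseteq>\<^bsub>weak_order n\<^esub> s" if "ps \<in> F" for ps
    unfolding le_weak_order_iff
  proof (intro ballI impI conjI)
    fix i j assume ij: "i \<in> {1..n}" "j \<in> {1..n}" "i < j"
    show "part_index s j \<le> part_index s i" if "part_index ps j \<le> part_index ps i"
      using \<open>ps \<in> F\<close> ij that unfolding sR[OF ij(2,1)] by (auto simp: R_def B_def)
    show "part_index s j < part_index s i" if "part_index ps j < part_index ps i"
      using \<open>ps \<in> F\<close> ij that AS unfolding sR'[OF ij(1,2)] by (auto simp: R_def A_def)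
  qed
  moreover have "s \<sqsubseteq>\<^bsub>weak_order n\<^esub> t" if t: "t \<in> Upper (weak_order n) F" for t
  proof -
    let ?g = "part_index t"
    have ub: "ps \<sqsubseteq>\<^bsub>weak_order n\<^esub> t" if "ps \<in> F" for ps
      using t that F by (auto simp: Upper_def)
    \<comment> \<open>Indices in \<open>t\<close> never drop along a chain in \<open>B\<close> and
      grow at a step in \<open>A\<close>, so \<open>t\<close> inherits all inversions of
      \<open>s\<close>.\<close>
    have tB: "?g x \<le> ?g y" if "(x, y) \<in> B" for x y
      using that ub by (auto simp: B_def le_weak_order_iff)
    have tA: "?g x < ?g y" if "(x, y) \<in> A" for x y
      using that ub by (auto simp: A_def le_weak_order_iff)
    have tBs: "?g x \<le> ?g y" if "(x, y) \<in> B\<^sup>*" for x y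
      using that by (induction rule: rtrancl_induct) (auto dest: tB)
    have tS: "?g x < ?g y" if "(x, y) \<in> S" for x y
      using that by (auto simp: S_def dest!: tA tBs)
    show ?thesis
      unfolding le_weak_order_iff
    proof (intro ballI impI conjI)
      fix i j assume ij: "i \<in> {1..n}" "j \<in> {1..n}" "i < j"
      show "?g j \<le> ?g i" if "part_index s j \<le> part_index s i"
        using ij that tBs unfolding sR[OF ij(2,1)] by (auto simp: R_def trancl_into_rtrancl)
      show "?g j < ?g i" if "part_index s j < part_index s i"
        using ij that tS unfolding sR'[OF ij(1,2)] by (auto simp: R_def)
    qed
  qed
  ultimately have "least (weak_order n) s (Upper (weak_order n) F)"
    using s by (auto simp: least_def Upper_def)
  then show ?thesis by blast
qed

text \<open>Reversing the list of parts would also reverse the weak order, but would move the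
  witnesses to the front. Relabelling the values keeps them behind \<open>a\<close> and
  \<open>c\<close>.\<close>

definition value_complement :: "nat \<Rightarrow> nat set list \<Rightarrow> nat set list" where
  "value_complement n ps = map (image (\<lambda>i. Suc n - i)) ps"

lemma value_complement_closed:
  assumes "ps \<in> ordered_partitions n"
  shows "value_complement n ps \<in> ordered_partitions n"
proof -
  have ps: "\<Union>(set ps) = {1..n}" "{} \<notin> set ps" "sorted_wrt disjnt ps"
    using assms by (auto simp: ordered_partitions_iff)
  have "(\<lambda>i. Suc n - i) ` {1..n} = {1..n}"
  proof
    show "{1..n} \<subseteq> (\<lambda>i. Suc n - i) ` {1..n}"
    proof
      fix i assume "i \<in> {1..n}"
      then show "i \<in> (\<lambda>i. Suc n - i) ` {1..n}" by (intro image_eqI[of _ _ "Suc n - i"]) auto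
    qed
  qed auto
  then have "\<Union>(set (value_complement n ps)) = {1..n}"
    using ps(1) by (simp add: value_complement_def flip: image_Union)
  moreover have "sorted_wrt disjnt (value_complement n ps)"
    unfolding value_complement_def sorted_wrt_map
  proof (rule sorted_wrt_mono_rel[OF _ ps(3)])
    fix a b assume "a \<in> set ps" "b \<in> set ps" "disjnt a b"
    moreover have "inj_on (\<lambda>i. Suc n - i) (a \<union> b)"
    proof (rule inj_on_subset)
      show "inj_on (\<lambda>i. Suc n - i) {1..n}" by (auto simp: inj_on_def)
      show "a \<union> b \<subseteq> {1..n}" using calculation ps(1) by blast
    qed
    ultimately show "disjnt ((\<lambda>i. Suc n - i) ` a) ((\<lambda>i. Suc n - i) ` b)"
      by (auto simp: disjnt_iff inj_on_def)
  qed
  ultimately show ?thesis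
    using ps(2) by (auto simp: ordered_partitions_iff value_complement_def)
qed

lemma image_complement_twice:
  assumes "a \<subseteq> {1..n}"
  shows "(\<lambda>i. Suc n - i) ` (\<lambda>i. Suc n - i) ` a = a"
proof -
  have "Suc n - (Suc n - i) = i" if "i \<in> a" for i
    using assms that by fastforce
  then show ?thesis by (simp add: image_image cong: image_cong_simp)
qed

lemma value_complement_twice:
  assumes "ps \<in> ordered_partitions n"
  shows "value_complement n (value_complement n ps) = ps"
proof -
  have "a \<subseteq> {1..n}" if "a \<in> set ps" for a
    using assms that by (auto simp: ordered_partitions_iff)
  then show ?thesis
    by (simp add: value_complement_def o_def image_complement_twice map_idI)
qed

lemma part_index_value_complement:
  assumes "ps \<in> ordered_partitions n" "i \<in> {1..n}"
  shows "part_index (value_complement n ps) i = part_index ps (Suc n - i)"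
proof (rule part_index_eqI)
  have i: "Suc n - i \<in> {1..n}" using assms(2) by auto
  note idx = part_index_mem[OF assms(1) i]
  show "value_complement n ps \<in> ordered_partitions n"
    using assms(1) by (rule value_complement_closed)
  show "part_index ps (Suc n - i) < length (value_complement n ps)"
    using idx by (simp add: value_complement_def)
  show "i \<in> value_complement n ps ! part_index ps (Suc n - i)"
    using idx assms(2) by (auto simp: value_complement_def intro!: image_eqI[of _ _ "Suc n - i"])
qed

lemma value_complement_antimono:
  assumes "ps \<in> ordered_partitions n" "qs \<in> ordered_partitions n" "ps \<sqsubseteq>\<^bsub>weak_order n\<^esub> qs"
  shows "value_complement n qs \<sqsubseteq>\<^bsub>weak_order n\<^esub> value_complement n ps"
  unfolding le_weak_order_iff
proof (intro ballI impI)
  fix i j assume ij: "i \<in> {1..n}" "j \<in> {1..n}" "i < j"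
  then have "Suc n - j \<in> {1..n}" "Suc n - i \<in> {1..n}" "Suc n - j < Suc n - i" by auto
  then show "(part_index (value_complement n qs) j \<le> part_index (value_complement n qs) i \<longrightarrow>
        part_index (value_complement n ps) j \<le> part_index (value_complement n ps) i) \<and>
      (part_index (value_complement n qs) j < part_index (value_complement n qs) i \<longrightarrow>
        part_index (value_complement n ps) j < part_index (value_complement n ps) i)"
    using assms(3) unfolding le_weak_order_iff
      part_index_value_complement[OF assms(1) ij(1)] part_index_value_complement[OF assms(1) ij(2)]
      part_index_value_complement[OF assms(2) ij(1)] part_index_value_complement[OF assms(2) ij(2)]
    by (meson not_less)
qed

lemma value_complement_le_iff:
  assumes "ps \<in> ordered_partitions n" "qs \<in> ordered_partitions n"
  shows "value_complement n ps \<sqsubseteq>\<^bsub>weak_order n\<^esub> qs \<longleftrightarrow> value_complement n qs \<sqsubseteq>\<^bsub>weak_order n\<^esub> ps"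
  using assms value_complement_antimono value_complement_closed value_complement_twice by metis

section \<open>The lattice property\<close>

lemma lattice_weak_order: "lattice (weak_order n)"
proof -
  interpret partial_order "weak_order n" by (rule partial_order_weak_order)
  show ?thesis
  proof unfold_locales
    fix x y assume "x \<in> carrier (weak_order n)" "y \<in> carrier (weak_order n)"
    then have xy: "x \<in> ordered_partitions n" "y \<in> ordered_partitions n" by auto
    then show "\<exists>s. least (weak_order n) s (Upper (weak_order n) {x, y})"
      by (intro weak_order_sup_exists) auto
    \<comment> \<open>The meet is the complement of the join of the complements.\<close>
    let ?c = "value_complement n"
    have cxy: "?c x \<in> ordered_partitions n" "?c y \<in> ordered_partitions n"
      using xy value_complement_closed by auto
    then obtain s where s: "least (weak_order n) s (Upper (weak_order n) {?c x, ?c y})"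
      using weak_order_sup_exists[of "{?c x, ?c y}" n] by auto
    then have sC: "s \<in> ordered_partitions n" using least_closed[OF s] by simp
    have "?c s \<sqsubseteq>\<^bsub>weak_order n\<^esub> z" if "z \<in> {x, y}" for z
    proof -
      have "?c z \<sqsubseteq>\<^bsub>weak_order n\<^esub> s" using that s cxy by (auto simp: least_def Upper_def)
      then show ?thesis using that xy sC value_complement_le_iff by blast
    qed
    moreover have "z \<sqsubseteq>\<^bsub>weak_order n\<^esub> ?c s" if "z \<in> Lower (weak_order n) {x, y}" for z
    proof -
      have z: "z \<in> ordered_partitions n" "z \<sqsubseteq>\<^bsub>weak_order n\<^esub> x" "z \<sqsubseteq>\<^bsub>weak_order n\<^esub> y"
        using that xy by (auto simp: Lower_def)
      then have "?c z \<in> Upper (weak_order n) {?c x, ?c y}"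
        using xy value_complement_antimono value_complement_closed by (auto simp: Upper_def)
      then have "s \<sqsubseteq>\<^bsub>weak_order n\<^esub> ?c z" using s by (simp add: least_def)
      then show ?thesis
        using value_complement_antimono[of s n "?c z"] sC z(1) value_complement_closed
          value_complement_twice[OF z(1)] by simp
    qed
    ultimately have "greatest (weak_order n) (?c s) (Lower (weak_order n) {x, y})"
      using sC value_complement_closed by (auto simp: greatest_def Lower_def)
    then show "\<exists>s. greatest (weak_order n) s (Lower (weak_order n) {x, y})" by blast
  qed
qed

subsection \<open>Hypertwist moves\<close>

lemma ordered_partitions_merge:
  "U @ [a, c] @ V \<in> ordered_partitions n \<Longrightarrow> U @ [a \<union> c] @ V \<in> ordered_partitions n"
  unfolding ordered_partitions_iff
  by (simp add: sorted_wrt_append ball_Un ball_conj_distrib disjnt_sym Un_ac conj_ac) blast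

lemma ordered_partitions_swap:
  "U @ [a, c] @ V \<in> ordered_partitions n \<Longrightarrow> U @ [c, a] @ V \<in> ordered_partitions n"
  unfolding ordered_partitions_iff
  by (simp add: sorted_wrt_append ball_Un ball_conj_distrib disjnt_sym Un_ac conj_ac)

lemma hypertwist_rule_closed:
  assumes "hypertwist_rule k n x y"
  shows "x \<in> ordered_partitions n" "y \<in> ordered_partitions n" "x \<noteq> y"
  using assms by (auto elim!: hypertwist_rule.cases
      dest: ordered_partitions_merge ordered_partitions_swap simp del: append.simps)

text \<open>Tabulates the position of a value in the three lists of a rewriting, which reduces later
  comparisons to linear arithmetic. The merged list is one part shorter, hence the shift in the case
  \<open>after\<close>.\<close>

lemma part_index_rewrite_cases:
  assumes P: "U @ [a, c] @ V \<in> ordered_partitions n" and i: "i \<in> {1..n}"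
  defines "f \<equiv> part_index (U @ [a, c] @ V) i"
    and "g \<equiv> part_index (U @ [a \<union> c] @ V) i"
    and "h \<equiv> part_index (U @ [c, a] @ V) i"
  obtains (first) "i \<in> a" "i \<notin> c" "f = length U" "g = length U" "h = Suc (length U)"
    | (second) "i \<in> c" "i \<notin> a" "f = Suc (length U)" "g = length U" "h = length U"
    | (before) "i \<notin> a" "i \<notin> c" "i \<notin> \<Union>(set V)" "f < length U" "g = f" "h = f"
    | (after) "i \<notin> a" "i \<notin> c" "i \<in> \<Union>(set V)" "f = Suc g" "g > length U" "h = f"
proof -
  note idx = part_index_eqI[OF P, of _ i] part_index_eqI[OF ordered_partitions_merge[OF P], of _ i]
    part_index_eqI[OF ordered_partitions_swap[OF P], of _ i]
  have disj: "disjnt a c" "\<And>v. v \<in> set V \<Longrightarrow> disjnt a v \<and> disjnt c v"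
    "\<And>u v. u \<in> set U \<Longrightarrow> v \<in> set V \<Longrightarrow> disjnt u v \<and> disjnt u a \<and> disjnt u c"
    "\<And>u. u \<in> set U \<Longrightarrow> disjnt u a \<and> disjnt u c"
    using P by (auto simp: ordered_partitions_iff sorted_wrt_append)
  have "i \<in> a \<or> i \<in> c \<or> (\<exists>q<length U. i \<in> U ! q) \<or> (\<exists>q<length V. i \<in> V ! q)"
  proof -
    have "i \<in> \<Union>(set (U @ [a, c] @ V))" using P i unfolding ordered_partitions_iff by blast
    then show ?thesis by (auto simp: in_set_conv_nth)
  qed
  then consider "i \<in> a" | "i \<in> c" | q where "q < length U" "i \<in> U ! q" | q where "q < length V" "i \<in> V ! q"
    by blast
  then show thesis
  proof cases
    case 1
    then show thesis
      using idx(1)[of "length U"] idx(2)[of "length U"] idx(3)[of "Suc (length U)"]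
      by (intro first) (use disj(1) in \<open>auto simp: disjnt_iff f_def g_def h_def nth_append\<close>)
  next
    case 2
    then show thesis
      using idx(1)[of "Suc (length U)"] idx(2)[of "length U"] idx(3)[of "length U"]
      by (intro second) (use disj(1) in \<open>auto simp: disjnt_iff f_def g_def h_def nth_append\<close>)
  next
    case 3
    have "i \<notin> a" "i \<notin> c" "i \<notin> \<Union>(set V)"
      using 3 disj(3,4) nth_mem[OF 3(1)] unfolding disjnt_iff by blast+
    then show thesis
      using 3 idx(1)[of q] idx(2)[of q] idx(3)[of q]
      by (intro before) (auto simp: f_def g_def h_def nth_append)
  next
    case 4
    have "i \<notin> a" "i \<notin> c"
      using 4 disj(2) nth_mem[OF 4(1)] unfolding disjnt_iff by blast+
    then show thesis
      using 4 idx(1)[of "Suc (Suc (length U + q))"] idx(2)[of "Suc (length U + q)"]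
        idx(3)[of "Suc (Suc (length U + q))"]
      by (intro after) (auto simp: f_def g_def h_def nth_append Suc_diff_le)
  qed
qed

section \<open>Moves increase the weak order\<close>

lemma hypertwist_cond_bounds:
  assumes P: "U @ [a, c] @ V \<in> ordered_partitions n" and "hypertwist_cond k a c V" and "k > 0"
  shows "Max a < Min c" "\<And>i. i \<in> a \<Longrightarrow> i \<le> Max a" "\<And>j. j \<in> c \<Longrightarrow> Min c \<le> j"
proof -
  obtain B where "card B = k" "\<forall>b\<in>B. Max a < b \<and> b < Min c"
    using assms(2) by (auto simp: hypertwist_cond_def)
  \<comment> \<open>Positivity of \<open>k\<close> enters here: a witness lies strictly between
    \<open>Max a\<close> and \<open>Min c\<close>.\<close>
  moreover from this have "B \<noteq> {}" using \<open>k > 0\<close> by auto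
  ultimately show "Max a < Min c" by force
  have "a \<union> c \<subseteq> {1..n}" using P unfolding ordered_partitions_iff by auto
  then have "finite a" "finite c" by (auto intro: finite_subset)
  then show "\<And>i. i \<in> a \<Longrightarrow> i \<le> Max a" "\<And>j. j \<in> c \<Longrightarrow> Min c \<le> j" by auto
qed

text \<open>Only pairs with one element in \<open>a\<close> and one in \<open>c\<close> change their
  relative position. The smaller lies in \<open>a\<close>, so \<open>coinv\<close> runs through -1,
  0, 1 along the two rules.\<close>

lemma hypertwist_rule_le:
  assumes "hypertwist_rule k n x y" "k > 0"
  shows "x \<sqsubseteq>\<^bsub>weak_order n\<^esub> y"
  using assms
proof (induction rule: hypertwist_rule.induct)
  case (merge U a c V)
  note bounds = hypertwist_cond_bounds[OF merge.hyps merge.prems]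
  show ?case
    unfolding le_weak_order_iff
  proof (intro ballI impI)
    fix i j assume ij: "i \<in> {1..n}" "j \<in> {1..n}" "i < j"
    show "(part_index (U @ [a, c] @ V) j \<le> part_index (U @ [a, c] @ V) i \<longrightarrow>
          part_index (U @ [a \<union> c] @ V) j \<le> part_index (U @ [a \<union> c] @ V) i) \<and>
        (part_index (U @ [a, c] @ V) j < part_index (U @ [a, c] @ V) i \<longrightarrow>
          part_index (U @ [a \<union> c] @ V) j < part_index (U @ [a \<union> c] @ V) i)"
      by (rule part_index_rewrite_cases[OF merge.hyps(1) ij(1)];
          rule part_index_rewrite_cases[OF merge.hyps(1) ij(2)];
          use ij(3) bounds(1) bounds(2)[of j] bounds(3)[of i] in linarith)
  qed
next
  case (split U a c V)
  note bounds = hypertwist_cond_bounds[OF split.hyps split.prems]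
  show ?case
    unfolding le_weak_order_iff
  proof (intro ballI impI)
    fix i j assume ij: "i \<in> {1..n}" "j \<in> {1..n}" "i < j"
    show "(part_index (U @ [a \<union> c] @ V) j \<le> part_index (U @ [a \<union> c] @ V) i \<longrightarrow>
          part_index (U @ [c, a] @ V) j \<le> part_index (U @ [c, a] @ V) i) \<and>
        (part_index (U @ [a \<union> c] @ V) j < part_index (U @ [a \<union> c] @ V) i \<longrightarrow>
          part_index (U @ [c, a] @ V) j < part_index (U @ [c, a] @ V) i)"
      by (rule part_index_rewrite_cases[OF split.hyps(1) ij(1)];
          rule part_index_rewrite_cases[OF split.hyps(1) ij(2)];
          use ij(3) bounds(1) bounds(2)[of j] bounds(3)[of i] in linarith)
  qed
qed

section \<open>Irreducible elements below the target of a move\<close>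

lemma Union_drop_ordered_partition:
  assumes "m \<in> ordered_partitions n" "b \<in> {1..n}" "p \<le> part_index m b"
  shows "b \<in> \<Union>(set (drop p m))"
proof -
  have "m ! part_index m b \<in> set (drop p m)"
    using part_index_mem(1)[OF assms(1,2)] assms(3)
    by (auto simp: in_set_conv_nth intro!: exI[of _ "part_index m b - p"])
  then show ?thesis using part_index_mem(2)[OF assms(1,2)] by blast
qed

text \<open>Either some part from that of \<open>j\<close> to that of \<open>i\<close> can be cut at \<open>s\<close>, or each of these parts
  lies on one side of the gap, and one above the gap is immediately followed by one below it.\<close>

lemma hypertwist_rule_into:
  assumes m: "m \<in> ordered_partitions n" and ij: "i \<in> {1..n}" "j \<in> {1..n}"
    and st: "s < t" "i \<le> s" "t \<le> j" and le: "part_index m j \<le> part_index m i"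
    and B: "B \<subseteq> {1..n}" "card B = k"
      "\<And>b. b \<in> B \<Longrightarrow> s < b \<and> b < t \<and> part_index m i < part_index m b"
    and gap: "\<And>d. \<lbrakk>d \<in> {1..n}; part_index m j \<le> part_index m d; part_index m d \<le> part_index m i\<rbrakk>
      \<Longrightarrow> d \<le> s \<or> t \<le> d"
  shows "\<exists>z. hypertwist_rule k n z m"
proof -
  let ?f = "part_index m"
  have finB: "finite B" using B(1) finite_subset by blast
  \<comment> \<open>The witnesses in \<open>B\<close> come after the part of \<open>i\<close>, so
    every suffix starting no later than just behind that part contains them.\<close>
  have cond: "hypertwist_cond k a c (drop p m)"
    if "a \<noteq> {}" "c \<noteq> {}" "finite a" "finite c" "\<And>x. x \<in> a \<Longrightarrow> x \<le> s" "\<And>x. x \<in> c \<Longrightarrow> t \<le> x"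
      "p \<le> Suc (?f i)" for a c p
    unfolding hypertwist_cond_def
  proof (intro exI[of _ B] conjI ballI)
    show "B \<subseteq> \<Union>(set (drop p m))"
      using B Union_drop_ordered_partition[OF m] that(7) by (meson Suc_leI le_trans subset_iff)
    show "Max a < b" "b < Min c" if "b \<in> B" for b
      using B(3)[OF that] Max_in[of a] Min_in[of c] \<open>a \<noteq> {}\<close> \<open>c \<noteq> {}\<close> \<open>finite a\<close> \<open>finite c\<close>
        \<open>\<And>x. x \<in> a \<Longrightarrow> x \<le> s\<close> \<open>\<And>x. x \<in> c \<Longrightarrow> t \<le> x\<close> by fastforce+
  qed (use finB B in auto)
  have len: "p < length m" if "p \<le> ?f i" for p
    using that part_index_mem(1)[OF m ij(1)] by simp
  have nth: "m ! p = {l \<in> {1..n}. ?f l = p}" if "p \<le> ?f i" for p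
    using nth_ordered_partition[OF m len[OF that]] .
  have sides: "d \<le> s \<or> t \<le> d" if "?f j \<le> p" "p \<le> ?f i" "d \<in> m ! p" for p d
    using gap[of d] that by (simp add: nth)
  show ?thesis
  proof (cases "\<exists>p. ?f j \<le> p \<and> p \<le> ?f i \<and> (\<exists>d\<in>m ! p. d \<le> s) \<and> (\<exists>d\<in>m ! p. t \<le> d)")
    case True
    then obtain p where p: "?f j \<le> p" "p \<le> ?f i" "\<exists>d\<in>m ! p. d \<le> s" "\<exists>d\<in>m ! p. t \<le> d" by blast
    \<comment> \<open>A part with values on both sides of the gap is the union of its low and its
      high values, so \<open>m\<close> is the result of a merge.\<close>
    define a where "a = {d \<in> m ! p. d \<le> s}"
    define c where "c = {d \<in> m ! p. t \<le> d}"
    have ac: "a \<union> c = m ! p" "a \<inter> c = {}" "a \<noteq> {}" "c \<noteq> {}"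
      using sides[OF p(1,2)] p(3,4) st(1) by (auto simp: a_def c_def)
    have m_eq: "m = take p m @ [a \<union> c] @ drop (Suc p) m"
      using id_take_nth_drop[OF len[OF p(2)]] ac(1) by simp
    have "finite (m ! p)" using nth[OF p(2)] by simp
    then have "hypertwist_cond k a c (drop (Suc p) m)"
      using ac p(2) by (intro cond) (auto simp: a_def c_def)
    moreover have "take p m @ [a, c] @ drop (Suc p) m \<in> ordered_partitions n"
      using m ac(2-4) by (subst (asm) m_eq) (simp add: ordered_partitions_iff sorted_wrt_append
          ball_Un ball_conj_distrib Un_ac disjnt_def Int_Un_distrib Int_Un_distrib2)
    ultimately have "hypertwist_rule k n (take p m @ [a, c] @ drop (Suc p) m) m"
      using hypertwist_rule.merge by (metis m_eq)
    then show ?thesis by blast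
  next
    case False
    \<comment> \<open>\<open>H\<close> holds at the part of \<open>j\<close> and fails at the part
      of \<open>i\<close>, so it is lost at some step from \<open>p\<close> to \<open>Suc p\<close>.
      No part is mixed, so \<open>m ! p\<close> is entirely high and \<open>m ! Suc p\<close>
      entirely low: the result of a split.\<close>
    define H where "H p \<longleftrightarrow> (\<exists>d\<in>m ! p. t \<le> d)" for p
    have "H (?f j)" using nth[OF le] ij st by (auto simp: H_def)
    moreover have "\<not> H (?f i)"
      using False nth[of "?f i"] ij st le unfolding H_def by blast
    ultimately obtain p where p: "?f j \<le> p" "p < ?f i" "H p" "\<not> H (Suc p)"
      using inc_induct[of "?f j" "?f i" "\<lambda>p. \<not> H p"] le by (metis)
    define a where "a = m ! Suc p"
    define c where "c = m ! p"
    have c_high: "t \<le> d" if "d \<in> c" for d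
      using that sides[of p d] False p unfolding H_def c_def by (meson less_imp_le)
    have a_low: "d \<le> s" if "d \<in> a" for d
      using that sides[of "Suc p" d] p unfolding H_def a_def by auto
    have m_eq: "m = take p m @ [c, a] @ drop (Suc (Suc p)) m"
      using id_take_nth_drop[of p m] Cons_nth_drop_Suc[of "Suc p" m] len[of p] len[of "Suc p"] p
      by (simp add: a_def c_def)
    have "finite a" "finite c" using nth[of p] nth[of "Suc p"] p by (auto simp: a_def c_def)
    moreover have "a \<noteq> {}" "c \<noteq> {}"
      using ordered_partition_nth_nonempty[OF m] len[of p] len[of "Suc p"] p
      by (auto simp: a_def c_def)
    ultimately have "hypertwist_cond k a c (drop (Suc (Suc p)) m)"
      using c_high a_low p(2) by (intro cond) auto
    moreover have "take p m @ [a, c] @ drop (Suc (Suc p)) m \<in> ordered_partitions n"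
      using m m_eq by (metis ordered_partitions_swap)
    ultimately have "hypertwist_rule k n (take p m @ [a \<union> c] @ drop (Suc (Suc p)) m) m"
      using hypertwist_rule.split by (metis m_eq)
    then show ?thesis by blast
  qed
qed

lemma irreducible_le_hypertwist_rule:
  assumes rule: "hypertwist_rule k n x y" and k: "k > 0" and m: "m \<in> ordered_partitions n"
    and irred: "\<nexists>z. hypertwist_rule k n z m" and my: "m \<sqsubseteq>\<^bsub>weak_order n\<^esub> y"
  shows "m \<sqsubseteq>\<^bsub>weak_order n\<^esub> x"
proof (rule ccontr)
  assume "\<not> m \<sqsubseteq>\<^bsub>weak_order n\<^esub> x"
  then obtain i j where ij: "i \<in> {1..n}" "j \<in> {1..n}" "i < j"
    and viol: "part_index m j \<le> part_index m i \<and> \<not> part_index x j \<le> part_index x i \<or>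
      part_index m j < part_index m i \<and> \<not> part_index x j < part_index x i"
    unfolding le_weak_order_iff by blast
  have le_y: "part_index y q \<le> part_index y p" if "p \<in> {1..n}" "q \<in> {1..n}" "p < q"
    "part_index m q \<le> part_index m p" for p q
    using my that unfolding le_weak_order_iff by blast
  have less_y: "part_index y q < part_index y p" if "p \<in> {1..n}" "q \<in> {1..n}" "p < q"
    "part_index m q < part_index m p" for p q
    using my that unfolding le_weak_order_iff by blast
  obtain U a c V where P: "U @ [a, c] @ V \<in> ordered_partitions n" and hc: "hypertwist_cond k a c V"
    and xy: "x = U @ [a, c] @ V \<and> y = U @ [a \<union> c] @ V \<or> x = U @ [a \<union> c] @ V \<and> y = U @ [c, a] @ V"
    using rule by (auto elim!: hypertwist_rule.cases)
  note bounds = hypertwist_cond_bounds[OF P hc k]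
  \<comment> \<open>As \<open>m\<close> is below \<open>y\<close> but fails to be below
    \<open>x\<close> at this pair, \<open>x\<close> and \<open>y\<close> differ there, which leaves
    only \<open>a\<close> and \<open>c\<close>.\<close>
  have pos: "i \<in> a \<and> j \<in> c" "part_index m j \<le> part_index m i"
  proof -
    show "part_index m j \<le> part_index m i" using viol by auto
    show "i \<in> a \<and> j \<in> c"
      by (rule part_index_rewrite_cases[OF P ij(1)]; rule part_index_rewrite_cases[OF P ij(2)];
          use ij(3) bounds(1) bounds(2)[of j] bounds(3)[of i] viol le_y[OF ij] less_y[OF ij] xy
          in \<open>elim disjE conjE; simp\<close>)
  qed
  note ac = pos(1)
  have i_pos: "part_index (U @ [a \<union> c] @ V) i = length U"
    "part_index (U @ [c, a] @ V) i = Suc (length U)"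
    by (rule part_index_rewrite_cases[OF P ij(1)]; use ac in simp)+
  have j_pos: "part_index (U @ [a \<union> c] @ V) j = length U"
    "part_index (U @ [c, a] @ V) j = length U"
    by (rule part_index_rewrite_cases[OF P ij(2)]; use ac in simp)+
  obtain B where B: "B \<subseteq> \<Union>(set V)" "card B = k" "\<And>b. b \<in> B \<Longrightarrow> Max a < b \<and> b < Min c"
    using hc by (auto simp: hypertwist_cond_def)
  have BC: "B \<subseteq> {1..n}" using B(1) P unfolding ordered_partitions_iff by auto
  \<comment> \<open>If \<open>m\<close> had \<open>b\<close> weakly before the smaller
    \<open>i\<close>, so would \<open>y\<close>; but in \<open>y\<close> the witness
    \<open>b\<close> stays in \<open>V\<close>, behind \<open>i\<close>.\<close>
  have after: "part_index m i < part_index m b" if "b \<in> B" for b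
  proof (rule ccontr)
    assume neg: "\<not> part_index m i < part_index m b"
    have b: "b \<in> {1..n}" "b \<in> \<Union>(set V)" using that BC B(1) by auto
    have bV: "b \<notin> a" "b \<notin> c"
      using B(3)[OF that] bounds(2)[of b] bounds(3)[of b] by auto
    have "i < b" using B(3)[OF that] bounds(2)[of i] ac by simp
    with neg have "part_index y b \<le> part_index y i" using le_y[OF ij(1) b(1)] by simp
    moreover have "length U < part_index (U @ [a \<union> c] @ V) b"
      "Suc (length U) < part_index (U @ [c, a] @ V) b"
      by (rule part_index_rewrite_cases[OF P b(1)]; use b(2) bV in auto)+
    ultimately show False using xy i_pos by auto
  qed
  \<comment> \<open>A value \<open>d\<close> strictly inside the gap would lie from the part of
    \<open>j\<close> to that of \<open>i\<close> in \<open>y\<close> as well. There these parts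
    coincide or are adjacent, which would force \<open>d\<close> into \<open>a\<close> or
    \<open>c\<close>.\<close>
  have gap: "d \<le> Max a \<or> Min c \<le> d"
    if d: "d \<in> {1..n}" "part_index m j \<le> part_index m d" "part_index m d \<le> part_index m i" for d
  proof (rule ccontr)
    assume "\<not> (d \<le> Max a \<or> Min c \<le> d)"
    then have between: "Max a < d" "d < Min c" by auto
    then have "i < d" "d < j" using bounds(2)[of i] bounds(3)[of j] ac by auto
    then have d_le: "part_index y d \<le> part_index y i" "part_index y j \<le> part_index y d"
      using le_y d ij by blast+
    have "d \<notin> a" "d \<notin> c" using between bounds(2)[of d] bounds(3)[of d] by auto
    then have "part_index (U @ [a \<union> c] @ V) d \<noteq> length U"
      "part_index (U @ [c, a] @ V) d < length U \<or> Suc (length U) < part_index (U @ [c, a] @ V) d"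
      by - (rule part_index_rewrite_cases[OF P d(1)]; simp)+
    then show False using d_le xy i_pos j_pos by auto
  qed
  have "\<exists>z. hypertwist_rule k n z m"
    using pos bounds BC B after gap
    by (intro hypertwist_rule_into[OF m ij(1,2), of "Max a" "Min c" B]) auto
  with irred show False by blast
qed

section \<open>Duality of the moves\<close>

lemma hypertwist_cond_complement:
  assumes P: "U @ [a, c] @ V \<in> ordered_partitions n" and hc: "hypertwist_cond k a c V"
  shows "hypertwist_cond k ((\<lambda>i. Suc n - i) ` c) ((\<lambda>i. Suc n - i) ` a) (value_complement n V)"
proof -
  let ?w = "\<lambda>i. Suc n - i"
  obtain B where B: "B \<subseteq> \<Union>(set V)" "finite B" "card B = k" "\<And>b. b \<in> B \<Longrightarrow> Max a < b \<and> b < Min c"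
    using hc by (auto simp: hypertwist_cond_def)
  have sub: "a \<subseteq> {1..n}" "c \<subseteq> {1..n}" "B \<subseteq> {1..n}" and ne: "a \<noteq> {}" "c \<noteq> {}"
    using P B(1) unfolding ordered_partitions_iff by auto
  then have fin: "finite a" "finite c" by (auto intro: finite_subset)
  have "inj_on ?w B"
  proof (rule inj_on_subset[OF _ sub(3)])
    show "inj_on ?w {1..n}" by (auto simp: inj_on_def)
  qed
  then have "card (?w ` B) = k" using B(3) by (simp add: card_image)
  moreover have "?w ` B \<subseteq> \<Union>(set (value_complement n V))"
    using B(1) by (auto simp: value_complement_def)
  moreover have "Max (?w ` c) < ?w b \<and> ?w b < Min (?w ` a)" if "b \<in> B" for b
  proof -
    have b: "b \<in> {1..n}" "Max a < b" "b < Min c" using B(4)[OF that] sub(3) that by auto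
    have "?w z < ?w b" if "z \<in> c" for z
      using Min_le[OF fin(2) that] b that sub(2) by auto
    moreover have "?w b < ?w z" if "z \<in> a" for z
      using Max_ge[OF fin(1) that] b that sub(1) by auto
    ultimately show ?thesis using fin ne by simp
  qed
  ultimately show ?thesis
    using B(2) unfolding hypertwist_cond_def by (intro exI[of _ "?w ` B"]) auto
qed

text \<open>After complementing, the image of \<open>c\<close> is the low part and that of
  \<open>a\<close> the high one. So \<open>U|a|c|V\<close> becomes the end of a split, and a merge
  read backwards becomes a split, and conversely.\<close>

lemma hypertwist_rule_complement:
  assumes "hypertwist_rule k n x y"
  shows "hypertwist_rule k n (value_complement n y) (value_complement n x)"
  using assms
proof (induction rule: hypertwist_rule.induct)
  case (merge U a c V)
  let ?w = "\<lambda>i. Suc n - i"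
  have "value_complement n U @ [?w ` c, ?w ` a] @ value_complement n V \<in> ordered_partitions n"
    using value_complement_closed[OF ordered_partitions_swap[OF merge(1)]]
    by (simp add: value_complement_def)
  from hypertwist_rule.split[OF this hypertwist_cond_complement[OF merge]]
  show ?case by (simp add: value_complement_def image_Un Un_commute)
next
  case (split U a c V)
  let ?w = "\<lambda>i. Suc n - i"
  have "value_complement n U @ [?w ` c, ?w ` a] @ value_complement n V \<in> ordered_partitions n"
    using value_complement_closed[OF ordered_partitions_swap[OF split(1)]]
    by (simp add: value_complement_def)
  from hypertwist_rule.merge[OF this hypertwist_cond_complement[OF split]]
  show ?case by (simp add: value_complement_def image_Un Un_commute)
qed

text \<open>Complementing exchanges forward and backward moves, so this is
  \<open>irreducible_le_hypertwist_rule\<close> transported along the complement.\<close>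

lemma hypertwist_rule_le_irreducible:
  assumes rule: "hypertwist_rule k n x y" and k: "k > 0" and m: "m \<in> ordered_partitions n"
    and irred: "\<nexists>z. hypertwist_rule k n m z" and xm: "x \<sqsubseteq>\<^bsub>weak_order n\<^esub> m"
  shows "y \<sqsubseteq>\<^bsub>weak_order n\<^esub> m"
proof -
  let ?c = "value_complement n"
  have xy: "x \<in> ordered_partitions n" "y \<in> ordered_partitions n"
    using hypertwist_rule_closed[OF rule] by auto
  have "\<nexists>z. hypertwist_rule k n z (?c m)"
    using irred hypertwist_rule_complement[of k n _ "?c m"] value_complement_twice[OF m] by metis
  then have "?c m \<sqsubseteq>\<^bsub>weak_order n\<^esub> ?c y"
    using irreducible_le_hypertwist_rule[OF hypertwist_rule_complement[OF rule] k]
      value_complement_antimono[OF xy(1) m xm] value_complement_closed[OF m] by blast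
  then show ?thesis
    using value_complement_antimono[of "?c m" n "?c y"] value_complement_closed
      value_complement_twice m xy(2) by metis
qed

text \<open>For \<open>k = 0\<close> the empty set of witnesses always works, so the first two parts
  can be merged until one part is left.\<close>

lemma hypertwist_zero_connected:
  assumes "ps \<in> ordered_partitions n" "ps \<noteq> []"
  shows "equivclp (hypertwist_rule 0 n) ps [{1..n}]"
  using assms
proof (induction "length ps" arbitrary: ps rule: less_induct)
  case less
  show ?case
  proof (cases "\<exists>a c V. ps = a # c # V")
    case True
    then obtain a c V where ps: "ps = [] @ [a, c] @ V" by auto
    have "hypertwist_cond 0 a c V" by (auto simp: hypertwist_cond_def)
    then have "hypertwist_rule 0 n ps ([] @ [a \<union> c] @ V)"
      using hypertwist_rule.merge less.prems(1) unfolding ps by blast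
    moreover have "equivclp (hypertwist_rule 0 n) ([] @ [a \<union> c] @ V) [{1..n}]"
      using less.prems(1) unfolding ps
      by (intro less.hyps ordered_partitions_merge) (auto simp: ps)
    ultimately show ?thesis by (meson r_into_equivclp equivclp_trans)
  next
    case False
    then obtain a where "ps = [a]" using less.prems(2) by (metis list.exhaust)
    then show ?thesis using less.prems(1) by (simp add: ordered_partitions_iff)
  qed
qed

theorem theorem141:
  fixes k n :: nat
  shows "lattice_congruence (weak_order n) (hypertwist_congruence k n)"
proof (cases "k = 0")
  case True
  \<comment> \<open>Here the side condition does not relate \<open>a\<close> and \<open>c\<close>, so the rules need not increase the
    weak order, but everything is congruent to the one-part partition.\<close>
  have "equivclp (hypertwist_rule 0 n) ps qs"
    if "ps \<in> ordered_partitions n" "qs \<in> ordered_partitions n" for ps qs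
  proof (cases "n = 0")
    case True
    \<comment> \<open>For \<open>n = 0\<close> the only ordered partition is the empty list;
      \<open>[{1..n}]\<close> would have an empty part.\<close>
    then have "ps = []" "qs = []"
      using that by (cases ps; cases qs; auto simp: ordered_partitions_iff)+
    then show ?thesis by simp
  next
    case False
    then have "ps \<noteq> []" "qs \<noteq> []" using that by (auto simp: ordered_partitions_iff)
    then show ?thesis
      using that hypertwist_zero_connected by (meson equivclp_sym equivclp_trans)
  qed
  then have "hypertwist_congruence k n = ordered_partitions n \<times> ordered_partitions n"
    using True by (auto simp: hypertwist_congruence_def)
  then show ?thesis
    using lattice_congruence_total[OF lattice_weak_order] finite_ordered_partitions by simp
next
  case False
  then have k: "k > 0" by simp
  have "lattice_congruence (weak_order n) {(x, y). x \<in> carrier (weak_order n) \<and>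
      y \<in> carrier (weak_order n) \<and> equivclp (hypertwist_rule k n) x y}"
  proof (rule lattice_congruence_of_moves[OF lattice_weak_order])
    show "finite (carrier (weak_order n))" by (simp add: finite_ordered_partitions)
    show "x \<in> carrier (weak_order n) \<and> y \<in> carrier (weak_order n) \<and>
        x \<sqsubseteq>\<^bsub>weak_order n\<^esub> y \<and> x \<noteq> y" if "hypertwist_rule k n x y" for x y
      using hypertwist_rule_closed[OF that] hypertwist_rule_le[OF that k] by simp
  qed (use k irreducible_le_hypertwist_rule hypertwist_rule_le_irreducible in auto)
  then show ?thesis by (simp add: hypertwist_congruence_def)
qed

end
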